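(* Let $n\ge1$, let $\lambda=(\lambda_1\ge\cdots\ge\lambda_n\ge0)$ be a partition (padded with zeros to length $n$), and set $A_{ij}=\lambda_i-\lambda_j+j-i$ for $1\le i<j\le n$. Then for every $\beta\in\mathbb{C}$, $$G_\lambda(\underbrace{1,\dots,1}_{n}\mid\beta)=|\mathrm{SST}(\lambda,n)|\cdot F^{(n)}\big((A_{ij})\,\big|\,(0,-1,\dots,-(n-1))^{T}\,\big|\,(1,\dots,1)^T\,\big|\,(-\beta,\dots,-\beta)^T\big),$$ where explicitly $$F^{(n)}\big((A_{ij})\,|\,(0,-1,\dots,-(n-1))^T\,|\,(1,\dots,1)^T\,|\,(z,\dots,z)^T\big)=\sum_{k_1,\dots,k_n\ge0}\Big(\prod_{1\le i<j\le n}\frac{A_{ij}+k_i-k_j}{A_{ij}}\Big)\prod_{i=1}^n\frac{(-(i-1))_{k_i}}{(1)_{k_i}}\,z^{k_i}$$ (a finite sum, since $(-(i-1))_{k_i}=0$ for $k_i>i-1$).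
   Context: Holman's hypergeometric function is $F^{(n)}\big((A_{ij})_{1\le i<j\le n}\,|\,(a_{ij})_{n\times u}\,|\,(b_{ij})_{n\times v}\,|\,(z_i)_{n\times1}\big)=\sum_{k_1,\dots,k_n\ge0}\Big(\prod_{i<j}\frac{A_{ij}+k_i-k_j}{A_{ij}}\Big)\Big(\prod_{j=1}^u\prod_{i=1}^n(a_{ij})_{k_i}\Big)\Big(\prod_{j=1}^v\prod_{i=1}^n\frac{1}{(b_{ij})_{k_i}}\Big)\prod_{i=1}^n z_i^{k_i}$, with $(a)_0=1$, $(a)_m=a(a+1)\cdots(a+m-1)$. Note $A_{ij}\ge1$ here. $\mathrm{SST}(\lambda,n)$ is the set of semistandard tableaux of shape $\lambda$ with entries in $[n]=\{1,\dots,n\}$ (rows weakly increasing, columns strictly increasing), and $|\mathrm{SST}(\lambda,n)|=\prod_{1\le i<j\le n}\frac{\lambda_i-\lambda_j+j-i}{j-i}$. The Grothendieck polynomial is $G_\lambda(x_1,\dots,x_n\mid\beta)=\sum_{T\in\mathrm{SVT}(\lambda,n)}\beta^{|T|-|\lambda|}x^{\omega(T)}$, where $\mathrm{SVT}(\lambda,n)$ is the set of set-valued tableaux: each box $(i,j)$ of the Young diagram of $\lambda$ (row $i$ downward, column $j$ rightward) gets a nonempty $T_{i,j}\subseteq[n]$ with $\max T_{i,j}\le\min T_{i,j+1}$ and $\max T_{i,j}<\min T_{i+1,j}$; $|T|=\sum|T_{i,j}|$, $|\lambda|=\sum\lambda_i$, $x^{\omega(T)}=\prod_m x_m^{\#\{\text{boxes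 whose set contains }m\}}$. *)

theory Defs
  imports "HOL-Analysis.Analysis"
begin

text \<open>Rows and columns are indexed from 1. The partition is lam :: nat \<Rightarrow> nat,
  only lam 1, ..., lam n are relevant.\<close>

definition is_partition :: "nat \<Rightarrow> (nat \<Rightarrow> nat) \<Rightarrow> bool" where
  "is_partition n lam \<longleftrightarrow> (\<forall>i. 1 \<le> i \<and> i < n \<longrightarrow> lam (Suc i) \<le> lam i)"

definition young_diagram :: "nat \<Rightarrow> (nat \<Rightarrow> nat) \<Rightarrow> (nat \<times> nat) set" where
  "young_diagram n lam = {(i, j). 1 \<le> i \<and> i \<le> n \<and> 1 \<le> j \<and> j \<le> lam i}"

definition size_part :: "nat \<Rightarrow> (nat \<Rightarrow> nat) \<Rightarrow> nat" where
  "size_part n lam = (\<Sum>i=1..n. lam i)"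

definition SST :: "nat \<Rightarrow> (nat \<Rightarrow> nat) \<Rightarrow> (nat \<times> nat \<Rightarrow> nat) set" where
  "SST n lam = {T. (\<forall>b. b \<notin> young_diagram n lam \<longrightarrow> T b = 0)
     \<and> (\<forall>b \<in> young_diagram n lam. T b \<in> {1..n})
     \<and> (\<forall>i j. (i, j) \<in> young_diagram n lam \<and> (i, Suc j) \<in> young_diagram n lam
              \<longrightarrow> T (i, j) \<le> T (i, Suc j))
     \<and> (\<forall>i j. (i, j) \<in> young_diagram n lam \<and> (Suc i, j) \<in> young_diagram n lam
              \<longrightarrow> T (i, j) < T (Suc i, j))}"

definition SVT :: "nat \<Rightarrow> (nat \<Rightarrow> nat) \<Rightarrow> (nat \<times> nat \<Rightarrow> nat set) set" where
  "SVT n lam = {T. (\<forall>b. b \<notin> young_diagram n lam \<longrightarrow> T b = {})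
     \<and> (\<forall>b \<in> young_diagram n lam. T b \<noteq> {} \<and> T b \<subseteq> {1..n})
     \<and> (\<forall>i j. (i, j) \<in> young_diagram n lam \<and> (i, Suc j) \<in> young_diagram n lam
              \<longrightarrow> Max (T (i, j)) \<le> Min (T (i, Suc j)))
     \<and> (\<forall>i j. (i, j) \<in> young_diagram n lam \<and> (Suc i, j) \<in> young_diagram n lam
              \<longrightarrow> Max (T (i, j)) < Min (T (Suc i, j)))}"

definition svt_size :: "nat \<Rightarrow> (nat \<Rightarrow> nat) \<Rightarrow> (nat \<times> nat \<Rightarrow> nat set) \<Rightarrow> nat" where
  "svt_size n lam T = (\<Sum>b\<in>young_diagram n lam. card (T b))"

definition svt_weight :: "nat \<Rightarrow> (nat \<Rightarrow> nat) \<Rightarrow> (nat \<times> nat \<Rightarrow> nat set) \<Rightarrow> nat \<Rightarrow> nat" where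
  "svt_weight n lam T m = card {b \<in> young_diagram n lam. m \<in> T b}"

definition grothendieck :: "nat \<Rightarrow> (nat \<Rightarrow> nat) \<Rightarrow> (nat \<Rightarrow> complex) \<Rightarrow> complex \<Rightarrow> complex" where
  "grothendieck n lam x \<beta> =
     (\<Sum>T\<in>SVT n lam. \<beta> ^ (svt_size n lam T - size_part n lam) *
        (\<Prod>m=1..n. x m ^ svt_weight n lam T m))"

text \<open>Holman's hypergeometric function F^(n)(A | a (n x u) | b (n x v) | z), as the
  (unordered) infinite sum over k : [n] \<rightarrow> \<nat> (k extended by 0 outside [n]).\<close>
definition holmanF :: "nat \<Rightarrow> (nat \<Rightarrow> nat \<Rightarrow> complex) \<Rightarrow> nat \<Rightarrow> (nat \<Rightarrow> nat \<Rightarrow> complex)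
    \<Rightarrow> nat \<Rightarrow> (nat \<Rightarrow> nat \<Rightarrow> complex) \<Rightarrow> (nat \<Rightarrow> complex) \<Rightarrow> complex" where
  "holmanF n A u a v b z = infsum (\<lambda>k::nat \<Rightarrow> nat.
      (\<Prod>i=1..n. \<Prod>j\<in>{i<..n}. (A i j + of_nat (k i) - of_nat (k j)) / A i j) *
      (\<Prod>j=1..u. \<Prod>i=1..n. pochhammer (a i j) (k i)) *
      (\<Prod>j=1..v. \<Prod>i=1..n. 1 / pochhammer (b i j) (k i)) *
      (\<Prod>i=1..n. z i ^ k i))
    {k. \<forall>i. i \<notin> {1..n} \<longrightarrow> k i = 0}"

end

theory Submission
  imports Defs "Jordan_Normal_Form.Determinant"
begin

text \<open>
  Deleting the largest letter \<open>n\<close> from a set-valued tableau of shape \<open>\<lambda>\<close> leaves a tableau on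
  \<open>n - 1\<close> letters whose shape \<open>\<mu>\<close> interlaces \<open>\<lambda>\<close>; besides the boxes of \<open>\<lambda>/\<mu>\<close>, the letter can
  have occurred exactly in the last box of those rows \<open>i\<close> with \<open>\<mu>_i > \<lambda>_(i+1)\<close>. At \<open>x = (1, ..., 1)\<close>
  this gives \<open>G_\<lambda> = \<Sum>_\<mu> (1 + \<beta>)^#{i. \<mu>_i > \<lambda>_(i+1)} G_\<mu>\<close>.

  Expanding Holman's series row by row turns \<open>|SST(\<lambda>, n)| F\<close> into the determinant of
  \<open>(1 + \<beta> E)^(i-1) binom(\<lambda>_i - i + n, n - j)\<close>, \<open>E\<close> being the unit shift in \<open>\<lambda>_i\<close>. The last column
  of this matrix is \<open>(1 + \<beta>)^(i-1)\<close>, so the row operation \<open>(1 + \<beta>) R_i - R_(i+1)\<close> clears it, and the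
  remaining minor is, by telescoping, the sum over interlacing \<open>\<mu>\<close> of the determinants of order
  \<open>n - 1\<close>. Hence both sides satisfy the same recursion if \<open>\<beta> \<noteq> -1\<close>, and \<open>\<beta> = -1\<close> follows by
  continuity. The count of semistandard tableaux is the case \<open>\<beta> = 0\<close>.
\<close>

section \<open>Determinants\<close>

lemma det_last_column:
  fixes A :: "'a :: comm_ring_1 mat"
  assumes A: "A \<in> carrier_mat (Suc n) (Suc n)"
    and zero: "\<And>i. i < n \<Longrightarrow> A $$ (i, n) = 0"
  shows "Determinant.det A = A $$ (n, n) * Determinant.det (Matrix.mat n n (($$) A))"
proof -
  have "Determinant.det A = (\<Sum>i<Suc n. A $$ (i, n) * cofactor A i n)"
    using laplace_expansion_column[OF A, of n] by simp
  also have "\<dots> = A $$ (n, n) * cofactor A n n"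
    using zero by simp
  also have "mat_delete A n n = Matrix.mat n n (($$) A)"
    using A by (intro eq_matI) (auto simp: mat_delete_def)
  hence "cofactor A n n = Determinant.det (Matrix.mat n n (($$) A))"
    by (simp add: cofactor_def flip: mult_2 power_mult)
  finally show ?thesis .
qed

text \<open>The operations amount to left multiplication by a matrix with \<open>c\<close> on the
  diagonal (1 in the last row) and -1 at \<open>(i, s i)\<close>. As \<open>s i > i\<close>, it is
  upper triangular of determinant \<open>c ^ n\<close>. The freedom in \<open>s\<close> serves two
  reductions: subtracting the last row from all others, and subtracting from each row its
  successor.\<close>

lemma det_row_operations:
  fixes A :: "'a :: comm_ring_1 mat"
  assumes A: "A \<in> carrier_mat (Suc n) (Suc n)"
    and s: "\<And>i. i < n \<Longrightarrow> i < s i \<and> s i \<le> n"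
  shows "c ^ n * Determinant.det A = Determinant.det (Matrix.mat (Suc n) (Suc n)
     (\<lambda>(i, j). if i < n then c * A $$ (i, j) - A $$ (s i, j) else A $$ (i, j)))"
    (is "_ = Determinant.det ?B")
proof -
  define U :: "'a mat" where "U = Matrix.mat (Suc n) (Suc n)
     (\<lambda>(i, j). if i < n then (if j = i then c else if j = s i then - 1 else 0)
               else if j = i then 1 else 0)"
  have U: "U \<in> carrier_mat (Suc n) (Suc n)" by (simp add: U_def)
  have "U * A = ?B"
  proof (rule eq_matI)
    fix i j assume "i < dim_row ?B" "j < dim_col ?B"
    hence ij: "i < Suc n" "j < Suc n" by auto
    have "(U * A) $$ (i, j) = (\<Sum>k = 0..<Suc n. U $$ (i, k) * A $$ (k, j))"
      using U A ij by (simp add: scalar_prod_def)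
    also have "\<dots> = ?B $$ (i, j)"
    proof (cases "i < n")
      case True
      have "(\<Sum>k = 0..<Suc n. U $$ (i, k) * A $$ (k, j)) =
            (\<Sum>k\<in>{i, s i}. U $$ (i, k) * A $$ (k, j))"
        using True s[OF True] by (intro sum.mono_neutral_right) (auto simp: U_def)
      also have "\<dots> = ?B $$ (i, j)"
        using True s[OF True] ij by (auto simp: U_def)
      finally show ?thesis .
    next
      case False
      hence "(\<Sum>k = 0..<Suc n. U $$ (i, k) * A $$ (k, j)) =
            (\<Sum>k\<in>{i}. U $$ (i, k) * A $$ (k, j))"
        using ij by (intro sum.mono_neutral_right) (auto simp: U_def)
      also have "\<dots> = ?B $$ (i, j)"
        using False ij by (auto simp: U_def)
      finally show ?thesis .
    qed
    finally show "(U * A) $$ (i, j) = ?B $$ (i, j)" .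
  qed (use U A in auto)
  moreover have "Determinant.det U = c ^ n"
  proof -
    have "upper_triangular U"
      using s by (auto simp: upper_triangular_def U_def) (metis less_asym less_trans)
    hence "Determinant.det U = prod_list (diag_mat U)"
      using U by (rule det_upper_triangular)
    also have "diag_mat U = replicate n c @ [1]"
      by (intro nth_equalityI) (auto simp: diag_mat_def U_def nth_append less_Suc_eq)
    finally show ?thesis by simp
  qed
  ultimately show ?thesis
    using det_mult[OF U A] by simp
qed

text \<open>The polynomial of the last column has degree 0, so subtracting the last row from the
  others clears that column. Row \<open>i\<close> then becomes divisible by the difference of
  \<open>x i\<close> and the last point; synthetic division lowers each degree by one, keeps the
  leading coefficient, and leaves a determinant of the same form on one point fewer.\<close>

lemma det_poly_Vandermonde:
  fixes x :: "nat \<Rightarrow> 'a :: idom"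
  assumes "\<And>j. j < n \<Longrightarrow> degree (p j) = n - Suc j"
  shows "Determinant.det (Matrix.mat n n (\<lambda>(i, j). poly (p j) (x i))) =
    (\<Prod>j<n. lead_coeff (p j)) * (\<Prod>i<n. \<Prod>j\<in>{i<..<n}. x i - x j)"
  using assms
proof (induction n arbitrary: p)
  case 0
  show ?case by simp
next
  case (Suc n)
  define A where "A = Matrix.mat (Suc n) (Suc n) (\<lambda>(i, j). poly (p j) (x i))"
  define q where "q j = synthetic_div (p j) (x n)" for j
  define B where "B = Matrix.mat (Suc n) (Suc n)
    (\<lambda>(i, j). if i < n then 1 * A $$ (i, j) - A $$ (n, j) else A $$ (i, j))"
  have A: "A \<in> carrier_mat (Suc n) (Suc n)" by (simp add: A_def)
  have deg_n: "degree (p n) = 0" using Suc.prems[of n] by simp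
  then obtain c where c: "p n = [:c:]" by (rule degree_eq_zeroE)
  have diff: "poly (p j) y - poly (p j) (x n) = (y - x n) * poly (q j) y" for j y
  proof -
    have "poly (p j + Polynomial.smult (x n) (q j)) y = poly (pCons (poly (p j) (x n)) (q j)) y"
      by (simp only: q_def synthetic_div_correct)
    thus ?thesis by (simp add: algebra_simps)
  qed
  have deg_q: "degree (q j) = n - Suc j" if "j < n" for j
    using Suc.prems[of j] that by (simp add: q_def degree_synthetic_div)
  have lead_q: "lead_coeff (q j) = lead_coeff (p j)" if "j < n" for j
  proof -
    have "coeff (p j + Polynomial.smult (x n) (q j)) (n - j) = coeff (pCons (poly (p j) (x n)) (q j)) (n - j)"
      by (simp only: q_def synthetic_div_correct)
    moreover have "n - j = Suc (n - Suc j)" using that by simp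
    moreover have "coeff (q j) (Suc (n - Suc j)) = 0"
      using deg_q[OF that] by (intro coeff_eq_0) simp
    ultimately show ?thesis
      using deg_q[OF that] Suc.prems[of j] that by simp
  qed
  have "Determinant.det A = Determinant.det B"
    using det_row_operations[OF A, of "\<lambda>_. n" 1] by (simp add: B_def)
  also have "\<dots> = B $$ (n, n) * Determinant.det (Matrix.mat n n (($$) B))"
    by (rule det_last_column) (auto simp: B_def A_def c)
  also have "B $$ (n, n) = lead_coeff (p n)"
    by (simp add: B_def A_def c)
  also have "Matrix.mat n n (($$) B) =
    Matrix.mat n n (\<lambda>(i, j). (x i - x n) * poly (q j) (x i))"
    by (intro eq_matI) (auto simp: B_def A_def diff)
  also have "Determinant.det \<dots> = (\<Prod>i<n. x i - x n) *
    Determinant.det (Matrix.mat n n (\<lambda>(i, j). poly (q j) (x i)))"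
    by (subst (1 2) det_def'[where n = n])
       (auto simp: prod.distrib sum_distrib_left mult_ac lessThan_atLeast0 permutes_in_image
             intro!: sum.cong)
  also have "Determinant.det (Matrix.mat n n (\<lambda>(i, j). poly (q j) (x i))) =
    (\<Prod>j<n. lead_coeff (q j)) * (\<Prod>i<n. \<Prod>j\<in>{i<..<n}. x i - x j)"
    by (rule Suc.IH) (rule deg_q)
  also have "(\<Prod>j<n. lead_coeff (q j)) = (\<Prod>j<n. lead_coeff (p j))"
    by (intro prod.cong refl lead_q) simp
  also have "lead_coeff (p n) * ((\<Prod>i<n. x i - x n) *
      ((\<Prod>j<n. lead_coeff (p j)) * (\<Prod>i<n. \<Prod>j\<in>{i<..<n}. x i - x j))) =
    (\<Prod>j<Suc n. lead_coeff (p j)) * (\<Prod>i<n. (x i - x n) * (\<Prod>j\<in>{i<..<n}. x i - x j))"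
    by (simp add: prod.distrib mult_ac)
  also have "(\<Prod>i<n. (x i - x n) * (\<Prod>j\<in>{i<..<n}. x i - x j)) =
    (\<Prod>i<n. \<Prod>j\<in>{i<..<Suc n}. x i - x j)"
  proof (intro prod.cong refl)
    fix i assume "i \<in> {..<n}"
    hence "{i<..<Suc n} = insert n {i<..<n}" by auto
    thus "(x i - x n) * (\<Prod>j\<in>{i<..<n}. x i - x j) = (\<Prod>j\<in>{i<..<Suc n}. x i - x j)"
      by simp
  qed
  also have "\<dots> = (\<Prod>i<Suc n. \<Prod>j\<in>{i<..<Suc n}. x i - x j)"
  proof -
    have "{n<..<Suc n} = {}" by auto
    thus ?thesis by simp
  qed
  finally show ?case by (simp add: A_def)
qed

lemma gbinomial_eq_poly:
  obtains q :: "'a :: field_char_0 poly"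
  where "degree q = k" "lead_coeff q = 1 / fact k" "\<And>x. poly q x = x gchoose k"
proof
  define r :: "'a poly" where "r = (\<Prod>i = 0..<k. [:- of_nat i, 1:])"
  have deg: "degree r = k"
    unfolding r_def by (subst degree_prod_eq_sum_degree) auto
  have lead: "lead_coeff r = 1"
    unfolding r_def by (simp add: lead_coeff_prod)
  show "degree (Polynomial.smult (1 / fact k) r) = k" using deg by simp
  show "lead_coeff (Polynomial.smult (1 / fact k) r) = 1 / fact k" using lead by simp
  show "poly (Polynomial.smult (1 / fact k) r) x = x gchoose k" for x
    by (simp add: r_def poly_prod gbinomial_prod_rev)
qed

lemma det_gbinomial:
  fixes x :: "nat \<Rightarrow> 'a :: field_char_0"
  shows "Determinant.det (Matrix.mat n n (\<lambda>(i, j). x i gchoose (n - Suc j))) =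
    (\<Prod>j<n. 1 / fact (n - Suc j)) * (\<Prod>i<n. \<Prod>j\<in>{i<..<n}. x i - x j)"
proof -
  have "\<exists>q :: nat \<Rightarrow> 'a poly. \<forall>k. degree (q k) = k \<and> lead_coeff (q k) = 1 / fact k \<and>
     (\<forall>x. poly (q k) x = x gchoose k)"
    by (intro choice allI) (metis gbinomial_eq_poly)
  then obtain q :: "nat \<Rightarrow> 'a poly" where q: "\<And>k. degree (q k) = k"
    "\<And>k. lead_coeff (q k) = 1 / fact k" "\<And>k x. poly (q k) x = x gchoose k"
    by blast
  have lead: "coeff (q k) k = 1 / fact k" for k
    using q(2)[of k] by (simp only: q(1))
  show ?thesis
    using det_poly_Vandermonde[of n "\<lambda>j. q (n - Suc j)" x] by (simp only: q(1,3) lead refl)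
qed

text \<open>Multilinearity in the rows: choosing one summand per row and adding over all choices
  gives the determinant of the row sums. Choice functions count rows from 1, matrices from 0. It
  serves both to expand into Holman's multiple sum and to collect the sum over interlacing
  shapes.\<close>

lemma sum_PiE_det:
  fixes F :: "nat \<Rightarrow> nat \<Rightarrow> 'b \<Rightarrow> 'a :: comm_ring_1"
  assumes "\<And>i. i \<in> {1..n} \<Longrightarrow> finite (B i)"
  shows "(\<Sum>g\<in>PiE {1..n} B. (\<Prod>i=1..n. w i (g i)) *
      Determinant.det (Matrix.mat n n (\<lambda>(i, j). F i j (g (Suc i))))) =
    Determinant.det (Matrix.mat n n (\<lambda>(i, j). \<Sum>y\<in>B (Suc i). w (Suc i) y * F i j y))"
proof -
  let ?P = "{p. p permutes {0..<n}}"
  have shift: "(\<Prod>i=0..<n. h (Suc i)) = (\<Prod>i=1..n. h i)" for h :: "nat \<Rightarrow> 'a"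
    by (rule prod.reindex_bij_witness[of _ "\<lambda>j. j - 1" Suc]) auto
  have det: "Determinant.det (Matrix.mat n n (\<lambda>(i, j). f i j)) =
    (\<Sum>p\<in>?P. signof p * (\<Prod>i=1..n. f (i - 1) (p (i - 1))))" for f :: "nat \<Rightarrow> nat \<Rightarrow> 'a"
    unfolding shift[symmetric]
    by (subst det_def'[where n = n]) (auto simp: permutes_in_image intro!: sum.cong prod.cong)
  have "(\<Sum>g\<in>PiE {1..n} B. (\<Prod>i=1..n. w i (g i)) *
      Determinant.det (Matrix.mat n n (\<lambda>(i, j). F i j (g (Suc i))))) =
    (\<Sum>g\<in>PiE {1..n} B. \<Sum>p\<in>?P. signof p *
       (\<Prod>i=1..n. w i (g i) * F (i - 1) (p (i - 1)) (g i)))"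
    unfolding det
    by (auto simp: sum_distrib_left prod.distrib mult_ac intro!: sum.cong prod.cong)
  also have "\<dots> = (\<Sum>p\<in>?P. signof p * (\<Sum>g\<in>PiE {1..n} B.
       (\<Prod>i=1..n. w i (g i) * F (i - 1) (p (i - 1)) (g i))))"
    by (subst sum.swap) (simp add: sum_distrib_left)
  also have "\<dots> = (\<Sum>p\<in>?P. signof p *
       (\<Prod>i=1..n. \<Sum>y\<in>B i. w i y * F (i - 1) (p (i - 1)) y))"
    by (subst prod_sum_PiE) (use assms in auto)
  \<comment> \<open>On \<open>{1..n}\<close> the index \<open>i\<close> equals
    \<open>Suc (i - 1)\<close>; in this form the factor matches the matrix entry in row
    \<open>i - 1\<close>.\<close>
  also have "\<dots> = (\<Sum>p\<in>?P. signof p *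
       (\<Prod>i=1..n. \<Sum>y\<in>B (Suc (i - 1)). w (Suc (i - 1)) y * F (i - 1) (p (i - 1)) y))"
    by (intro sum.cong prod.cong arg_cong2[where f = "(*)"] refl) auto
  finally show ?thesis unfolding det .
qed

section \<open>The determinant of shifted binomial coefficients and its branching rule\<close>

text \<open>The operator \<open>(1 + \<beta> E)^p\<close> applied to a binomial coefficient, where \<open>E\<close> is the unit shift
  in \<open>a\<close>; rows \<open>p\<close> and columns \<open>j\<close> count from 0, while parts of \<open>lam\<close> count from 1.\<close>

definition shifted_gbinomial ::
  "nat \<Rightarrow> 'a :: field_char_0 \<Rightarrow> nat \<Rightarrow> nat \<Rightarrow> 'a \<Rightarrow> 'a" where
  "shifted_gbinomial n \<beta> p j a = (\<Sum>k\<le>p. of_nat (p choose k) * \<beta> ^ k *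
     ((a + of_nat n + of_nat k - of_nat (Suc p)) gchoose (n - Suc j)))"

definition grothendieck_det :: "nat \<Rightarrow> 'a :: field_char_0 \<Rightarrow> (nat \<Rightarrow> nat) \<Rightarrow> 'a" where
  "grothendieck_det n \<beta> lam = Determinant.det (Matrix.mat n n
     (\<lambda>(i, j). shifted_gbinomial n \<beta> i j (of_nat (lam (Suc i)))))"

text \<open>Pascal's rule in every summand. Entries of order \<open>n\<close> become backward
  differences in \<open>a\<close> of entries of order \<open>n + 1\<close>, so their sums over an
  interval telescope.\<close>

lemma shifted_gbinomial_diff:
  assumes "j < n"
  shows "shifted_gbinomial n \<beta> p j a =
    shifted_gbinomial (Suc n) \<beta> p j a - shifted_gbinomial (Suc n) \<beta> p j (a - 1)"
proof -
  obtain r where r: "n - j = Suc r" "n - Suc j = r" using assms by (metis Suc_diff_Suc)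
  have "(a + of_nat (Suc n) + of_nat k - of_nat (Suc p)) gchoose (Suc r) =
     ((a + of_nat n + of_nat k - of_nat (Suc p)) gchoose r) +
     ((a - 1 + of_nat (Suc n) + of_nat k - of_nat (Suc p)) gchoose (Suc r))" for k
    using gbinomial_Suc_Suc[of "a + of_nat n + of_nat k - of_nat (Suc p)" r]
    by (simp add: algebra_simps)
  thus ?thesis
    unfolding shifted_gbinomial_def diff_Suc_Suc r
    by (simp add: sum_subtractf[symmetric] algebra_simps)
qed

text \<open>This is \<open>(1 + \<beta> E)^(p + 1) = (1 + \<beta> E)^p (1 + \<beta> E)\<close>, with
  \<open>E\<close> shifting the index of \<open>g\<close>.\<close>

lemma sum_choose_Suc:
  fixes g :: "nat \<Rightarrow> 'a :: comm_ring_1"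
  shows "(\<Sum>k\<le>Suc p. of_nat (Suc p choose k) * \<beta> ^ k * g k) =
    (\<Sum>k\<le>p. of_nat (p choose k) * \<beta> ^ k * (g k + \<beta> * g (Suc k)))"
proof -
  have "(\<Sum>k\<le>Suc p. of_nat (Suc p choose k) * \<beta> ^ k * g k) =
    g 0 + (\<Sum>k\<le>p. of_nat (p choose Suc k) * \<beta> ^ Suc k * g (Suc k)) +
    (\<Sum>k\<le>p. of_nat (p choose k) * \<beta> ^ Suc k * g (Suc k))"
    by (subst sum.atMost_Suc_shift) (simp add: sum.distrib[symmetric] algebra_simps)
  also have "g 0 + (\<Sum>k\<le>p. of_nat (p choose Suc k) * \<beta> ^ Suc k * g (Suc k)) =
    (\<Sum>k\<le>Suc p. of_nat (p choose k) * \<beta> ^ k * g k)"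
    by (subst sum.atMost_Suc_shift) simp
  also have "\<dots> = (\<Sum>k\<le>p. of_nat (p choose k) * \<beta> ^ k * g k)"
    by (simp add: binomial_eq_0)
  finally show ?thesis
    by (simp add: sum.distrib algebra_simps)
qed

text \<open>One factor \<open>1 + \<beta> E\<close> is split off. Row \<open>p + 1\<close> also
  starts from an argument lower by one than row \<open>p\<close>, hence the identity contributes at
  \<open>a - 1\<close> and \<open>\<beta> E\<close> at \<open>a\<close>.\<close>

lemma shifted_gbinomial_Suc:
  "shifted_gbinomial n \<beta> (Suc p) j a =
    shifted_gbinomial n \<beta> p j (a - 1) + \<beta> * shifted_gbinomial n \<beta> p j a"
proof -
  have "a + of_nat n + of_nat k - of_nat (Suc (Suc p)) = a - 1 + of_nat n + of_nat k - of_nat (Suc p)"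
    "a + of_nat n + of_nat (Suc k) - of_nat (Suc (Suc p)) = a + of_nat n + of_nat k - of_nat (Suc p)" for k
    by (auto simp: algebra_simps)
  thus ?thesis
    unfolding shifted_gbinomial_def sum_choose_Suc
    by (simp only:) (simp add: sum.distrib sum_distrib_left ring_distribs mult_ac del: of_nat_Suc)
qed

text \<open>In the last column all binomial coefficients in \<open>a\<close> have lower index 0 and
  equal 1, so the binomial theorem remains.\<close>

lemma shifted_gbinomial_last: "shifted_gbinomial (Suc n) \<beta> p n a = (1 + \<beta>) ^ p"
  using binomial_ring[of \<beta> 1 p] by (simp add: shifted_gbinomial_def add.commute)

text \<open>Write \<open>f\<close> for the entry of order \<open>n + 1\<close> in row
  \<open>p\<close>. With weight \<open>1 + \<beta>\<close> throughout, the sum telescopes to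
  \<open>(1 + \<beta>) (f a - f (b - 1))\<close>. The term \<open>y = b\<close> has weight 1 only,
  which removes \<open>\<beta> (f b - f (b - 1))\<close>. In total
  \<open>f (b - 1) + \<beta> f b\<close> is subtracted, and this is the entry of row
  \<open>p + 1\<close> at \<open>b\<close>.\<close>

lemma sum_shifted_gbinomial:
  fixes \<beta> :: "'a :: field_char_0"
  assumes "j < n" "b \<le> a"
  shows "(\<Sum>y\<in>{b..a}. (if b < y then 1 + \<beta> else 1) * shifted_gbinomial n \<beta> p j (of_nat y)) =
    (1 + \<beta>) * shifted_gbinomial (Suc n) \<beta> p j (of_nat a) -
    shifted_gbinomial (Suc n) \<beta> (Suc p) j (of_nat b)"
  using assms(2)
proof (induction a rule: dec_induct)
  case base
  show ?case
    by (simp add: shifted_gbinomial_diff[OF assms(1)] shifted_gbinomial_Suc algebra_simps)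
next
  case (step a)
  have "{b..Suc a} = insert (Suc a) {b..a}" using step by auto
  thus ?case
    using step by (simp add: shifted_gbinomial_diff[OF assms(1)] algebra_simps)
qed

lemma grothendieck_det_branching:
  fixes \<beta> :: "'a :: field_char_0"
  assumes \<beta>: "1 + \<beta> \<noteq> 0" and part: "is_partition (Suc m) lam"
  shows "grothendieck_det (Suc m) \<beta> lam =
    (\<Sum>\<mu>\<in>PiE {1..m} (\<lambda>i. {lam (Suc i)..lam i}).
       (\<Prod>i=1..m. if lam (Suc i) < \<mu> i then 1 + \<beta> else 1) * grothendieck_det m \<beta> \<mu>)"
proof -
  define A where "A = Matrix.mat (Suc m) (Suc m)
     (\<lambda>(i, j). shifted_gbinomial (Suc m) \<beta> i j (of_nat (lam (Suc i))))"
  define B where "B = Matrix.mat (Suc m) (Suc m)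
    (\<lambda>(i, j). if i < m then (1 + \<beta>) * A $$ (i, j) - A $$ (Suc i, j) else A $$ (i, j))"
  have A: "A \<in> carrier_mat (Suc m) (Suc m)" by (simp add: A_def)
  have "(1 + \<beta>) ^ m * Determinant.det A = Determinant.det B"
    using det_row_operations[OF A, of Suc] by (simp add: B_def)
  also have "\<dots> = B $$ (m, m) * Determinant.det (Matrix.mat m m (($$) B))"
    by (rule det_last_column) (auto simp: B_def A_def shifted_gbinomial_last)
  also have "B $$ (m, m) = (1 + \<beta>) ^ m"
    by (simp add: B_def A_def shifted_gbinomial_last)
  \<comment> \<open>Both sides carry the factor \<open>(1 + \<beta>) ^ m\<close>, one from the row
    operations and one from the corner entry; cancelling it requires
    \<open>1 + \<beta> \<noteq> 0\<close>.\<close>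
  finally have "Determinant.det A = Determinant.det (Matrix.mat m m (($$) B))"
    using \<beta> by simp
  also have "Matrix.mat m m (($$) B) = Matrix.mat m m (\<lambda>(i, j).
     \<Sum>y\<in>{lam (Suc (Suc i))..lam (Suc i)}. (if lam (Suc (Suc i)) < y then 1 + \<beta> else 1) *
       shifted_gbinomial m \<beta> i j (of_nat y))"
  proof (rule eq_matI, goal_cases)
    case (1 i j)
    hence "lam (Suc (Suc i)) \<le> lam (Suc i)" using part by (simp add: is_partition_def)
    thus ?case using 1 by (simp add: sum_shifted_gbinomial B_def A_def)
  qed auto
  also have "Determinant.det \<dots> = (\<Sum>\<mu>\<in>PiE {1..m} (\<lambda>i. {lam (Suc i)..lam i}).
       (\<Prod>i=1..m. if lam (Suc i) < \<mu> i then 1 + \<beta> else 1) * grothendieck_det m \<beta> \<mu>)"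
    unfolding grothendieck_det_def
    by (rule sum_PiE_det[symmetric, of m "\<lambda>i. {lam (Suc i)..lam i}"
          "\<lambda>i y. if lam (Suc i) < y then 1 + \<beta> else 1"
          "\<lambda>i j y. shifted_gbinomial m \<beta> i j (of_nat y)"]) auto
  finally show ?thesis by (simp add: A_def grothendieck_det_def)
qed

text \<open>Multilinearity chooses one \<open>k i < i\<close> per row and leaves determinants of
  binomial coefficients in \<open>lam i + n + k i - i\<close>, which are of Vandermonde type. The
  differences of these arguments are the numerators of Holman's series. The formula holds for every
  \<open>\<beta>\<close> and displays the determinant as a polynomial in
  \<open>\<beta>\<close>.\<close>

lemma grothendieck_det_expansion:
  fixes \<beta> :: "'a :: field_char_0"
  shows "grothendieck_det n \<beta> lam = (\<Prod>j<n. 1 / fact (n - Suc j)) *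
    (\<Sum>k\<in>PiE {1..n} (\<lambda>i. {..<i}). (\<Prod>i=1..n. of_nat ((i - 1) choose k i) * \<beta> ^ k i) *
      (\<Prod>i=1..n. \<Prod>j\<in>{i<..n}. of_int (int (lam i) - int (lam j) + int j - int i) +
         of_nat (k i) - of_nat (k j)))"
proof -
  define x :: "(nat \<Rightarrow> nat) \<Rightarrow> nat \<Rightarrow> 'a"
    where "x k i = of_nat (lam i) + of_nat n + of_nat (k i) - of_nat i" for k i
  have differences: "(\<Prod>i<n. \<Prod>j\<in>{i<..<n}. x k (Suc i) - x k (Suc j)) =
     (\<Prod>i=1..n. \<Prod>j\<in>{i<..n}. of_int (int (lam i) - int (lam j) + int j - int i) +
         of_nat (k i) - of_nat (k j))" for k
  proof -
    have "(\<Prod>j\<in>{i<..<n}. x k (Suc i) - x k (Suc j)) = (\<Prod>j\<in>{Suc i<..n}. x k (Suc i) - x k j)" for i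
      by (rule prod.reindex_bij_witness[of _ "\<lambda>j. j - 1" Suc]) auto
    moreover have "(\<Prod>i<n. f (Suc i)) = (\<Prod>i=1..n. f i)" for f :: "nat \<Rightarrow> 'a"
      by (rule prod.reindex_bij_witness[of _ "\<lambda>j. j - 1" Suc]) auto
    ultimately have "(\<Prod>i<n. \<Prod>j\<in>{i<..<n}. x k (Suc i) - x k (Suc j)) =
      (\<Prod>i=1..n. \<Prod>j\<in>{i<..n}. x k i - x k j)"
      by simp
    thus ?thesis
      by (simp add: x_def algebra_simps)
  qed
  have "grothendieck_det n \<beta> lam = Determinant.det (Matrix.mat n n
     (\<lambda>(i, j). \<Sum>y\<in>{..<Suc i}. of_nat ((Suc i - 1) choose y) * \<beta> ^ y *
       ((of_nat (lam (Suc i)) + of_nat n + of_nat y - of_nat (Suc i)) gchoose (n - Suc j))))"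
    unfolding grothendieck_det_def shifted_gbinomial_def by (simp only: lessThan_Suc_atMost diff_Suc_1)
  also have "\<dots> = (\<Sum>k\<in>PiE {1..n} (\<lambda>i. {..<i}).
     (\<Prod>i=1..n. of_nat ((i - 1) choose k i) * \<beta> ^ k i) *
      Determinant.det (Matrix.mat n n (\<lambda>(i, j). x k (Suc i) gchoose (n - Suc j))))"
    unfolding x_def
    by (rule sum_PiE_det[symmetric, of n "\<lambda>i. {..<i}"
          "\<lambda>i y. of_nat ((i - 1) choose y) * \<beta> ^ y"]) auto
  also have "\<dots> = (\<Prod>j<n. 1 / fact (n - Suc j)) *
    (\<Sum>k\<in>PiE {1..n} (\<lambda>i. {..<i}). (\<Prod>i=1..n. of_nat ((i - 1) choose k i) * \<beta> ^ k i) *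
      (\<Prod>i<n. \<Prod>j\<in>{i<..<n}. x k (Suc i) - x k (Suc j)))"
    unfolding det_gbinomial by (simp add: sum_distrib_left mult_ac)
  finally show ?thesis unfolding differences .
qed

section \<open>Branching of set-valued tableaux\<close>

lemma young_diagram_iff:
  "(i, j) \<in> young_diagram n lam \<longleftrightarrow> 1 \<le> i \<and> i \<le> n \<and> 1 \<le> j \<and> j \<le> lam i"
  by (simp add: young_diagram_def)

lemma young_diagram_eq_Sigma: "young_diagram n lam = (SIGMA i:{1..n}. {1..lam i})"
  by (auto simp: young_diagram_def)

lemma finite_young_diagram [simp]: "finite (young_diagram n lam)"
  by (simp add: young_diagram_eq_Sigma)

lemma card_young_diagram: "card (young_diagram n lam) = size_part n lam"
  by (simp add: young_diagram_eq_Sigma size_part_def)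

text \<open>For nonempty finite sets, comparing \<open>Max\<close> with \<open>Min\<close> means
  comparing all pairs of elements. This form is inherited when letters are deleted.\<close>

lemma SVT_iff:
  "T \<in> SVT n lam \<longleftrightarrow>
     (\<forall>b. b \<notin> young_diagram n lam \<longrightarrow> T b = {}) \<and>
     (\<forall>b\<in>young_diagram n lam. T b \<noteq> {} \<and> T b \<subseteq> {1..n}) \<and>
     (\<forall>i j. (i, j) \<in> young_diagram n lam \<and> (i, Suc j) \<in> young_diagram n lam \<longrightarrow>
        (\<forall>x\<in>T (i, j). \<forall>y\<in>T (i, Suc j). x \<le> y)) \<and>
     (\<forall>i j. (i, j) \<in> young_diagram n lam \<and> (Suc i, j) \<in> young_diagram n lam \<longrightarrow>
        (\<forall>x\<in>T (i, j). \<forall>y\<in>T (Suc i, j). x < y))"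
proof -
  have le: "Max A \<le> Min B \<longleftrightarrow> (\<forall>x\<in>A. \<forall>y\<in>B. x \<le> y)"
    and less: "Max A < Min B \<longleftrightarrow> (\<forall>x\<in>A. \<forall>y\<in>B. x < y)"
    if "A \<noteq> {} \<and> A \<subseteq> {1..n}" "B \<noteq> {} \<and> B \<subseteq> {1..n}" for A B :: "nat set"
    using that finite_subset[of A "{1..n}"] finite_subset[of B "{1..n}"] by auto
  show ?thesis
  \<comment> \<open>\<open>Max\<close> and \<open>Min\<close> are meaningful only on nonempty finite
    sets; if this clause fails, both sides are false.\<close>
  proof (cases "\<forall>b\<in>young_diagram n lam. T b \<noteq> {} \<and> T b \<subseteq> {1..n}")
    case True
    thus ?thesis unfolding SVT_def using le less
      by (auto simp del: Max_less_iff Min_gr_iff Max_le_iff Min_ge_iff)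
  next
    case False
    thus ?thesis unfolding SVT_def by blast
  qed
qed

lemma SVT_outside: "T \<in> SVT n lam \<Longrightarrow> b \<notin> young_diagram n lam \<Longrightarrow> T b = {}"
  and SVT_nonempty: "T \<in> SVT n lam \<Longrightarrow> b \<in> young_diagram n lam \<Longrightarrow> T b \<noteq> {}"
  by (simp_all add: SVT_iff del: split_paired_All)

lemma SVT_mem:
  assumes "T \<in> SVT n lam" "x \<in> T b"
  shows "b \<in> young_diagram n lam" "1 \<le> x" "x \<le> n"
  using assms unfolding SVT_iff by (metis atLeastAtMost_iff empty_iff subsetD)+

lemma SVT_row:
  assumes "T \<in> SVT n lam" "x \<in> T (i, j)" "y \<in> T (i, Suc j)"
  shows "x \<le> y"
  using assms SVT_mem(1)[OF assms(1,2)] SVT_mem(1)[OF assms(1,3)] unfolding SVT_iff by blast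

lemma SVT_column:
  assumes "T \<in> SVT n lam" "x \<in> T (i, j)" "y \<in> T (Suc i, j)"
  shows "x < y"
  using assms SVT_mem(1)[OF assms(1,2)] SVT_mem(1)[OF assms(1,3)] unfolding SVT_iff by blast

lemma finite_SVT: "finite (SVT n lam)"
proof (rule finite_subset)
  show "SVT n lam \<subseteq> {T. \<forall>b. (b \<in> young_diagram n lam \<longrightarrow> T b \<in> Pow {1..n}) \<and>
      (b \<notin> young_diagram n lam \<longrightarrow> T b = {})}"
    by (auto simp: SVT_def)
qed (intro finite_set_of_finite_funs, auto)

lemma finite_SVT_entry: "T \<in> SVT n lam \<Longrightarrow> finite (T b)"
  by (rule finite_subset[of _ "{..n}"]) (auto intro: SVT_mem(3))

lemma young_diagram_up:
  assumes "is_partition n lam" "(Suc i, j) \<in> young_diagram n lam" "1 \<le> i"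
  shows "(i, j) \<in> young_diagram n lam"
proof -
  have "lam (Suc i) \<le> lam i"
    using assms unfolding is_partition_def by (auto simp: young_diagram_iff)
  thus ?thesis using assms(2,3) by (simp add: young_diagram_iff)
qed

text \<open>Columns increase strictly from a letter that is at least 1. In particular, row
  \<open>m + 1\<close> of a tableau on \<open>m + 1\<close> letters contains only the letter
  \<open>m + 1\<close>.\<close>

lemma SVT_row_index_le:
  assumes part: "is_partition n lam" and T: "T \<in> SVT n lam"
  shows "x \<in> T (i, j) \<Longrightarrow> i \<le> x"
proof (induction i arbitrary: x)
  case (Suc i)
  show ?case
  proof (cases "i = 0")
    case True
    thus ?thesis using SVT_mem(2)[OF T Suc.prems] by simp
  next
    case False
    hence "(i, j) \<in> young_diagram n lam"
      using young_diagram_up[OF part SVT_mem(1)[OF T Suc.prems]] by simp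
    then obtain y where "y \<in> T (i, j)" using SVT_nonempty[OF T] by blast
    thus ?thesis using Suc.IH SVT_column[OF T _ Suc.prems] by fastforce
  qed
qed simp

text \<open>It lets the row lengths of the inner shape be defined as cardinalities.\<close>

lemma initial_segment_eq_atLeastAtMost_card:
  assumes "finite D" "0 \<notin> D" "\<And>j. 1 \<le> j \<Longrightarrow> Suc j \<in> D \<Longrightarrow> j \<in> D"
  shows "D = {1..card D}"
proof (cases "D = {}")
  case False
  have "j \<in> D" if "1 \<le> j" "j \<le> Max D" for j
    using that(2,1)
  proof (induction j rule: inc_induct)
    case base
    show ?case using assms(1) False by simp
  next
    case (step k)
    thus ?case using assms(3)[of k] by auto
  qed
  moreover have "j \<le> Max D" "1 \<le> j" if "j \<in> D" for j
    using that assms(1,2) by (auto simp: Suc_le_eq intro!: gr0I)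
  ultimately have "D = {1..Max D}"
    by (intro Set.set_eqI) (unfold atLeastAtMost_iff, blast)
  moreover from this have "card D = Max D" by (metis card_atLeastAtMost diff_Suc_1)
  ultimately show ?thesis by simp
qed simp

section \<open>Encoding by interlacing shapes and corner rows\<close>

text \<open>The next three definitions give the bijection between tableaux \<open>T\<close> on \<open>m + 1\<close> letters and
  triples (shape \<open>\<mu>\<close>, tableau of shape \<open>\<mu>\<close> on \<open>m\<close> letters, set of rows in which \<open>m + 1\<close> shares a
  box with a smaller letter).\<close>

definition inner_shape :: "nat \<Rightarrow> (nat \<times> nat \<Rightarrow> nat set) \<Rightarrow> nat \<Rightarrow> nat" where
  "inner_shape m T = (\<lambda>i\<in>{1..m}. card {j. T (i, j) - {Suc m} \<noteq> {}})"

definition shared_rows :: "nat \<Rightarrow> (nat \<times> nat \<Rightarrow> nat set) \<Rightarrow> nat set" where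
  "shared_rows m T = {i\<in>{1..m}. \<exists>j. Suc m \<in> T (i, j) \<and> T (i, j) - {Suc m} \<noteq> {}}"

definition add_largest :: "nat \<Rightarrow> (nat \<Rightarrow> nat) \<Rightarrow> (nat \<Rightarrow> nat) \<Rightarrow> (nat \<times> nat \<Rightarrow> nat set) \<Rightarrow>
    nat set \<Rightarrow> nat \<times> nat \<Rightarrow> nat set" where
  "add_largest m lam \<mu> T S = (\<lambda>(i, j). T (i, j) \<union>
     (if (i, j) \<in> young_diagram (Suc m) lam \<and> (i, j) \<notin> young_diagram m \<mu> \<or> i \<in> S \<and> j = \<mu> i
      then {Suc m} else {}))"

text \<open>The condition says that \<lambda>/\<mu> is a horizontal strip. \<open>PiE\<close> fixes
  the values outside \<open>{1..m}\<close>, so that every shape is represented once.\<close>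

definition interlacing :: "nat \<Rightarrow> (nat \<Rightarrow> nat) \<Rightarrow> (nat \<Rightarrow> nat) set" where
  "interlacing m lam = PiE {1..m} (\<lambda>i. {lam (Suc i)..lam i})"

text \<open>In these rows the last box of \<mu> has no box of \<lambda> below it, so the letter
  \<open>m + 1\<close> may join it.\<close>

definition corner_rows :: "nat \<Rightarrow> (nat \<Rightarrow> nat) \<Rightarrow> (nat \<Rightarrow> nat) \<Rightarrow> nat set" where
  "corner_rows m lam \<mu> = {i\<in>{1..m}. lam (Suc i) < \<mu> i}"

lemma interlacing_bounds:
  "\<mu> \<in> interlacing m lam \<Longrightarrow> 1 \<le> i \<Longrightarrow> i \<le> m \<Longrightarrow> lam (Suc i) \<le> \<mu> i \<and> \<mu> i \<le> lam i"
  unfolding interlacing_def by (drule PiE_mem[where x = i]) auto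

lemma finite_interlacing: "finite (interlacing m lam)"
  by (auto simp: interlacing_def intro!: finite_PiE)

lemma is_partition_interlacing:
  assumes "\<mu> \<in> interlacing m lam"
  shows "is_partition m \<mu>"
  unfolding is_partition_def
proof (intro allI impI)
  fix i assume "1 \<le> i \<and> i < m"
  thus "\<mu> (Suc i) \<le> \<mu> i"
    using interlacing_bounds[OF assms, of i] interlacing_bounds[OF assms, of "Suc i"] by simp
qed

lemma young_diagram_interlacing_subset:
  assumes "\<mu> \<in> interlacing m lam"
  shows "young_diagram m \<mu> \<subseteq> young_diagram (Suc m) lam"
proof
  fix b assume b: "b \<in> young_diagram m \<mu>"
  obtain i j where "b = (i, j)" by (cases b)
  thus "b \<in> young_diagram (Suc m) lam"
    using b interlacing_bounds[OF assms, of i] by (simp add: young_diagram_iff)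
qed

section \<open>Deletion of the largest letter\<close>

context
  fixes m :: nat and lam :: "nat \<Rightarrow> nat"
    and T :: "nat \<times> nat \<Rightarrow> nat set"
  assumes part: "is_partition (Suc m) lam" and T: "T \<in> SVT (Suc m) lam"
begin

text \<open>To the left of a letter below \<open>m + 1\<close> all letters are below
  \<open>m + 1\<close>, so in each row the boxes with such a letter form an initial segment. Row
  \<open>m + 1\<close> has none, since entries are at least their row index.\<close>

lemma inner_shape_iff:
  "T (i, j) - {Suc m} \<noteq> {} \<longleftrightarrow> (i, j) \<in> young_diagram m (inner_shape m T)"
proof -
  define D where "D = {j. T (i, j) - {Suc m} \<noteq> {}}"
  have sub: "D \<subseteq> {1..lam i}"
    using SVT_mem(1)[OF T] by (fastforce simp: D_def young_diagram_iff)
  have "D = {1..card D}"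
  proof (rule initial_segment_eq_atLeastAtMost_card)
    fix j assume j: "1 \<le> j" "Suc j \<in> D"
    then obtain x where x: "x \<in> T (i, Suc j)" "x \<noteq> Suc m" by (auto simp: D_def)
    have "(i, j) \<in> young_diagram (Suc m) lam"
      using SVT_mem(1)[OF T x(1)] j by (simp add: young_diagram_iff)
    then obtain y where y: "y \<in> T (i, j)" using SVT_nonempty[OF T] by blast
    have "y \<le> x" using SVT_row[OF T y x(1)] .
    hence "y \<noteq> Suc m" using SVT_mem(3)[OF T x(1)] x(2) by simp
    thus "j \<in> D" using y by (auto simp: D_def)
  qed (use sub in \<open>auto intro: finite_subset\<close>)
  moreover have "D = {}" if "i \<notin> {1..m}"
  proof -
    have "x = Suc m" if "x \<in> T (i, j)" for x j
      using SVT_row_index_le[OF part T that] SVT_mem[OF T that] \<open>i \<notin> {1..m}\<close>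
      by (auto simp: young_diagram_iff)
    thus ?thesis by (auto simp: D_def)
  qed
  ultimately have "j \<in> D \<longleftrightarrow> i \<in> {1..m} \<and> 1 \<le> j \<and> j \<le> card D"
    by (metis atLeastAtMost_iff empty_iff)
  thus ?thesis
    by (auto simp: D_def inner_shape_def young_diagram_iff)
qed

text \<open>Lower bound: the box above the last box of row \<open>i + 1\<close> has only letters
  smaller than some letter \<open>\<le> m + 1\<close>, hence belongs to the inner shape. Upper
  bound: the inner shape consists of boxes of \<lambda>.\<close>

lemma inner_shape_interlacing: "inner_shape m T \<in> interlacing m lam"
proof -
  have "inner_shape m T i \<in> {lam (Suc i)..lam i}" if i: "i \<in> {1..m}" for i
  proof -
    have "lam (Suc i) \<le> inner_shape m T i"
    proof (cases "lam (Suc i) = 0")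
      case False
      define j where "j = lam (Suc i)"
      have "(Suc i, j) \<in> young_diagram (Suc m) lam"
        using False i by (simp add: j_def young_diagram_iff)
      moreover from this have "(i, j) \<in> young_diagram (Suc m) lam"
        using young_diagram_up[OF part] i by simp
      ultimately obtain x y where xy: "x \<in> T (i, j)" "y \<in> T (Suc i, j)"
        using SVT_nonempty[OF T] by blast
      hence "x < Suc m" using SVT_column[OF T xy] SVT_mem(3)[OF T xy(2)] by simp
      hence "T (i, j) - {Suc m} \<noteq> {}" using xy by auto
      thus ?thesis unfolding inner_shape_iff by (simp add: young_diagram_iff j_def)
    qed simp
    moreover have "inner_shape m T i \<le> lam i"
    proof (cases "inner_shape m T i = 0")
      case False
      hence "(i, inner_shape m T i) \<in> young_diagram m (inner_shape m T)"
        using i by (simp add: young_diagram_iff)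
      then obtain x where "x \<in> T (i, inner_shape m T i)" unfolding inner_shape_iff[symmetric] by auto
      thus ?thesis using SVT_mem(1)[OF T] by (auto simp: young_diagram_iff)
    qed simp
    ultimately show ?thesis by simp
  qed
  thus ?thesis by (auto simp: interlacing_def inner_shape_def)
qed

text \<open>To the right of \<open>m + 1\<close> only \<open>m + 1\<close> can stand, and below it
  nothing.\<close>

lemma largest_entry_in_inner_shape:
  assumes "Suc m \<in> T (i, j)" "(i, j) \<in> young_diagram m (inner_shape m T)"
  shows "j = inner_shape m T i" "lam (Suc i) < j"
proof -
  have ij: "1 \<le> i" "i \<le> m" "1 \<le> j" "j \<le> inner_shape m T i"
    using assms(2) by (auto simp: young_diagram_iff)
  show "j = inner_shape m T i"
  proof (rule ccontr)
    assume "j \<noteq> inner_shape m T i"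
    hence "(i, Suc j) \<in> young_diagram m (inner_shape m T)"
      using ij by (simp add: young_diagram_iff)
    then obtain y where y: "y \<in> T (i, Suc j)" "y \<noteq> Suc m" unfolding inner_shape_iff[symmetric] by auto
    thus False using SVT_row[OF T assms(1) y(1)] SVT_mem(3)[OF T y(1)] by simp
  qed
  show "lam (Suc i) < j"
  proof (rule ccontr)
    assume "\<not> lam (Suc i) < j"
    hence "(Suc i, j) \<in> young_diagram (Suc m) lam" using ij by (simp add: young_diagram_iff)
    then obtain y where y: "y \<in> T (Suc i, j)" using SVT_nonempty[OF T] by blast
    thus False using SVT_column[OF T assms(1) y] SVT_mem(3)[OF T y] by simp
  qed
qed

lemma remove_largest_SVT: "(\<lambda>b. T b - {Suc m}) \<in> SVT m (inner_shape m T)"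
  unfolding SVT_iff
proof (intro conjI allI ballI impI; (elim conjE)?)
  fix b assume "b \<notin> young_diagram m (inner_shape m T)"
  thus "T b - {Suc m} = {}" using inner_shape_iff by (cases b) blast
next
  fix b assume "b \<in> young_diagram m (inner_shape m T)"
  thus "T b - {Suc m} \<noteq> {}" using inner_shape_iff by (cases b) blast
next
  fix b
  show "T b - {Suc m} \<subseteq> {1..m}"
  proof
    fix x assume "x \<in> T b - {Suc m}"
    thus "x \<in> {1..m}" using SVT_mem(2,3)[OF T, of x b] by simp
  qed
next
  fix i j x y assume "x \<in> T (i, j) - {Suc m}" "y \<in> T (i, Suc j) - {Suc m}"
  thus "x \<le> y" using SVT_row[OF T] by blast
next
  fix i j x y assume "x \<in> T (i, j) - {Suc m}" "y \<in> T (Suc i, j) - {Suc m}"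
  thus "x < y" using SVT_column[OF T] by blast
qed

lemma shared_rows_iff:
  "i \<in> shared_rows m T \<longleftrightarrow>
    (i, inner_shape m T i) \<in> young_diagram m (inner_shape m T) \<and> Suc m \<in> T (i, inner_shape m T i)"
proof
  assume "i \<in> shared_rows m T"
  then obtain j where j: "Suc m \<in> T (i, j)" "T (i, j) - {Suc m} \<noteq> {}"
    by (auto simp: shared_rows_def)
  thus "(i, inner_shape m T i) \<in> young_diagram m (inner_shape m T) \<and> Suc m \<in> T (i, inner_shape m T i)"
    unfolding inner_shape_iff using largest_entry_in_inner_shape(1) by metis
next
  assume *: "(i, inner_shape m T i) \<in> young_diagram m (inner_shape m T) \<and> Suc m \<in> T (i, inner_shape m T i)"
  hence "T (i, inner_shape m T i) - {Suc m} \<noteq> {}" unfolding inner_shape_iff by blast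
  thus "i \<in> shared_rows m T"
    using * unfolding shared_rows_def by (auto simp: young_diagram_iff)
qed

lemma shared_rows_subset: "shared_rows m T \<subseteq> corner_rows m lam (inner_shape m T)"
  using largest_entry_in_inner_shape(2)
  by (auto simp: shared_rows_iff corner_rows_def young_diagram_iff)

lemma add_largest_remove_largest:
  "add_largest m lam (inner_shape m T) (\<lambda>b. T b - {Suc m}) (shared_rows m T) = T"
proof
  fix b :: "nat \<times> nat"
  obtain i j where b: "b = (i, j)" by (cases b)
  have "Suc m \<in> T (i, j) \<longleftrightarrow> (i, j) \<in> young_diagram (Suc m) lam \<and>
      (i, j) \<notin> young_diagram m (inner_shape m T) \<or> i \<in> shared_rows m T \<and> j = inner_shape m T i"
    (is "_ \<longleftrightarrow> ?R")
  proof
    assume *: "Suc m \<in> T (i, j)"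
    show ?R
      using largest_entry_in_inner_shape(1)[OF *] SVT_mem(1)[OF T *] *
      by (cases "(i, j) \<in> young_diagram m (inner_shape m T)") (auto simp: shared_rows_iff)
  next
    assume ?R
    thus "Suc m \<in> T (i, j)"
      using inner_shape_iff[of i j] SVT_nonempty[OF T, of "(i, j)"] by (auto simp: shared_rows_iff)
  qed
  thus "add_largest m lam (inner_shape m T) (\<lambda>b. T b - {Suc m}) (shared_rows m T) b = T b"
    by (auto simp: add_largest_def b)
qed

text \<open>Boxes outside the inner shape contain just \<open>m + 1\<close> and contribute 1.
  Inside, deleting \<open>m + 1\<close> from a box costs one factor \<open>\<beta>\<close>, and
  there is exactly one such box in each shared row.\<close>

lemma SVT_weight_branching:
  fixes \<beta> :: "'a :: comm_ring_1"
  shows "(\<Prod>b\<in>young_diagram (Suc m) lam. \<beta> ^ (card (T b) - 1)) =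
    \<beta> ^ card (shared_rows m T) *
    (\<Prod>b\<in>young_diagram m (inner_shape m T). \<beta> ^ (card (T b - {Suc m}) - 1))"
proof -
  let ?Y = "young_diagram m (inner_shape m T)"
  have "(\<Prod>b\<in>young_diagram (Suc m) lam. \<beta> ^ (card (T b) - 1)) = (\<Prod>b\<in>?Y. \<beta> ^ (card (T b) - 1))"
  proof (rule prod.mono_neutral_right)
    show "?Y \<subseteq> young_diagram (Suc m) lam"
      by (rule young_diagram_interlacing_subset[OF inner_shape_interlacing])
    show "\<forall>b\<in>young_diagram (Suc m) lam - ?Y. \<beta> ^ (card (T b) - 1) = 1"
    proof
      fix b assume "b \<in> young_diagram (Suc m) lam - ?Y"
      hence "T b - {Suc m} = {}" using inner_shape_iff by (cases b) blast
      hence "T b = {} \<or> T b = {Suc m}" by blast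
      hence "card (T b) - 1 = 0" by (elim disjE) simp_all
      thus "\<beta> ^ (card (T b) - 1) = 1" by simp
    qed
  qed simp
  also have "\<dots> = (\<Prod>b\<in>?Y. (if Suc m \<in> T b then \<beta> else 1) * \<beta> ^ (card (T b - {Suc m}) - 1))"
  proof (rule prod.cong)
    fix b assume "b \<in> ?Y"
    hence "T b - {Suc m} \<noteq> {}" using inner_shape_iff by (cases b) blast
    \<comment> \<open>As the remaining set is nonempty, the truncated subtractions of 1 are
      exact.\<close>
    hence "card (T b - {Suc m}) \<noteq> 0" using finite_SVT_entry[OF T] by simp
    then obtain r where "card (T b - {Suc m}) = Suc r" by (metis not0_implies_Suc)
    thus "\<beta> ^ (card (T b) - 1) = (if Suc m \<in> T b then \<beta> else 1) * \<beta> ^ (card (T b - {Suc m}) - 1)"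
      using card.remove[of "T b" "Suc m"] finite_SVT_entry[OF T] by auto
  qed simp
  also have "\<dots> = \<beta> ^ card {b\<in>?Y. Suc m \<in> T b} * (\<Prod>b\<in>?Y. \<beta> ^ (card (T b - {Suc m}) - 1))"
    by (simp add: prod.distrib prod.If_cases Int_def)
  also have "{b\<in>?Y. Suc m \<in> T b} = (\<lambda>i. (i, inner_shape m T i)) ` shared_rows m T"
    using largest_entry_in_inner_shape(1) by (auto simp: shared_rows_iff image_iff)
  also have "card \<dots> = card (shared_rows m T)"
    by (intro card_image inj_onI) auto
  finally show ?thesis .
qed

end

section \<open>Restoration of the largest letter\<close>

context
  fixes m :: nat and lam \<mu> :: "nat \<Rightarrow> nat" and T :: "nat \<times> nat \<Rightarrow> nat set" and S :: "nat set"
  assumes \<mu>: "\<mu> \<in> interlacing m lam" and T: "T \<in> SVT m \<mu>" and S: "S \<subseteq> corner_rows m lam \<mu>"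
begin

lemma corner_in_young_diagram: "i \<in> S \<Longrightarrow> (i, \<mu> i) \<in> young_diagram m \<mu>"
  using S by (auto simp: corner_rows_def young_diagram_iff)

lemma largest_not_in: "Suc m \<notin> T b"
  using SVT_mem(3)[OF T] by fastforce

lemma remove_largest_add_largest: "add_largest m lam \<mu> T S b - {Suc m} = T b"
  using largest_not_in by (cases b) (auto simp: add_largest_def)

lemma inner_shape_add_largest: "inner_shape m (add_largest m lam \<mu> T S) = \<mu>"
proof
  fix i
  show "inner_shape m (add_largest m lam \<mu> T S) i = \<mu> i"
  proof (cases "i \<in> {1..m}")
    case True
    have "T (i, j) \<noteq> {} \<longleftrightarrow> j \<in> {1..\<mu> i}" for j
      using SVT_outside[OF T, of "(i, j)"] SVT_nonempty[OF T, of "(i, j)"] True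
      by (auto simp: young_diagram_iff)
    hence "{j. T (i, j) \<noteq> {}} = {1..\<mu> i}" by blast
    thus ?thesis using True by (simp add: inner_shape_def remove_largest_add_largest)
  next
    case False
    thus ?thesis using \<mu> by (auto simp: inner_shape_def interlacing_def PiE_def extensional_def)
  qed
qed

lemma shared_rows_add_largest: "shared_rows m (add_largest m lam \<mu> T S) = S"
proof -
  have "Suc m \<in> add_largest m lam \<mu> T S (i, j) \<and> T (i, j) \<noteq> {} \<longleftrightarrow> i \<in> S \<and> j = \<mu> i" for i j
    using SVT_outside[OF T, of "(i, j)"] SVT_nonempty[OF T, of "(i, j)"]
      largest_not_in[of "(i, j)"] corner_in_young_diagram[of i]
    by (auto simp: add_largest_def)
  thus ?thesis
    using S by (auto simp: shared_rows_def remove_largest_add_largest corner_rows_def)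
qed

text \<open>As \<open>m + 1\<close> is the largest letter, an added one could do harm only to the
  left of a smaller letter or above any letter. The first is excluded because letters are added only
  outside \<mu> or at the ends of its rows. The second is excluded because a box with a box of
  \<lambda> below it lies in \<mu> by interlacing and is not the end of a row in
  \<open>S\<close>.\<close>

lemma add_largest_SVT: "add_largest m lam \<mu> T S \<in> SVT (Suc m) lam"
proof -
  let ?U = "add_largest m lam \<mu> T S"
  note sub = young_diagram_interlacing_subset[OF \<mu>]
  have mem: "x = Suc m \<and> ((i, j) \<in> young_diagram m \<mu> \<longrightarrow> i \<in> S \<and> j = \<mu> i) \<or> x \<in> T (i, j)"
    if "x \<in> ?U (i, j)" for x i j
    using that by (auto simp: add_largest_def split: if_splits)
  have bounds: "1 \<le> x \<and> x \<le> Suc m" if "x \<in> ?U b" for x b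
    using that SVT_mem(2,3)[OF T, of x b] by (cases b) (auto simp: add_largest_def split: if_splits)
  show ?thesis
    unfolding SVT_iff
  proof (intro conjI allI ballI impI; (elim conjE)?)
    fix b assume "b \<notin> young_diagram (Suc m) lam"
    thus "?U b = {}"
      using sub SVT_outside[OF T, of b] corner_in_young_diagram
      by (cases b) (auto simp: add_largest_def)
  next
    fix b assume "b \<in> young_diagram (Suc m) lam"
    thus "?U b \<noteq> {}"
      using SVT_nonempty[OF T, of b] by (cases b) (auto simp: add_largest_def)
  next
    fix b
    show "?U b \<subseteq> {1..Suc m}"
      by (intro subsetI) (unfold atLeastAtMost_iff, rule bounds)
  next
    fix i j x y
    assume ij: "(i, j) \<in> young_diagram (Suc m) lam"
      and x: "x \<in> ?U (i, j)" and y: "y \<in> ?U (i, Suc j)"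
    show "x \<le> y"
    proof (cases "y = Suc m")
      case True
      thus ?thesis using bounds[OF x] by simp
    next
      case False
      hence yT: "y \<in> T (i, Suc j)" using mem[OF y] by simp
      hence "(i, Suc j) \<in> young_diagram m \<mu>" by (rule SVT_mem(1)[OF T])
      hence "(i, j) \<in> young_diagram m \<mu>" "j \<noteq> \<mu> i"
        using ij by (auto simp: young_diagram_iff)
      hence "x \<in> T (i, j)" using mem[OF x] by blast
      thus ?thesis using SVT_row[OF T _ yT] by blast
    qed
  next
    fix i j x y
    assume ij: "(i, j) \<in> young_diagram (Suc m) lam" "(Suc i, j) \<in> young_diagram (Suc m) lam"
      and x: "x \<in> ?U (i, j)" and y: "y \<in> ?U (Suc i, j)"
    have *: "1 \<le> i" "i \<le> m" "1 \<le> j" "j \<le> lam (Suc i)" using ij by (auto simp: young_diagram_iff)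
    hence "(i, j) \<in> young_diagram m \<mu>"
      using interlacing_bounds[OF \<mu>, of i] by (simp add: young_diagram_iff)
    moreover have "\<not> (i \<in> S \<and> j = \<mu> i)" using S * by (auto simp: corner_rows_def)
    ultimately have xT: "x \<in> T (i, j)" using mem[OF x] by blast
    show "x < y"
    proof (cases "y = Suc m")
      case True
      thus ?thesis using SVT_mem(3)[OF T xT] by simp
    next
      case False
      hence "y \<in> T (Suc i, j)" using mem[OF y] by simp
      thus ?thesis using SVT_column[OF T xT] by blast
    qed
  qed
qed

end

section \<open>The branching rule for the weighted sum over tableaux\<close>

text \<open>The power of \<open>\<beta>\<close> is distributed over the boxes, so that deleting a
  letter acts box by box.\<close>

definition svt_sum :: "nat \<Rightarrow> 'a :: comm_ring_1 \<Rightarrow> (nat \<Rightarrow> nat) \<Rightarrow> 'a" where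
  "svt_sum n \<beta> lam = (\<Sum>T\<in>SVT n lam. \<Prod>b\<in>young_diagram n lam. \<beta> ^ (card (T b) - 1))"

text \<open>Once \<mu> is fixed, the set \<open>S\<close> of shared rows ranges over all subsets of
  the corner rows independently of the smaller tableau, so \<open>\<beta> ^ card S\<close> sums to
  one factor \<open>1 + \<beta>\<close> per corner row.\<close>

lemma svt_sum_branching:
  fixes \<beta> :: "'a :: comm_ring_1"
  assumes part: "is_partition (Suc m) lam"
  shows "svt_sum (Suc m) \<beta> lam = (\<Sum>\<mu>\<in>interlacing m lam.
    (\<Prod>i=1..m. if lam (Suc i) < \<mu> i then 1 + \<beta> else 1) * svt_sum m \<beta> \<mu>)"
proof -
  define wt :: "(nat \<Rightarrow> nat) \<Rightarrow> (nat \<times> nat \<Rightarrow> nat set) \<Rightarrow> 'a"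
    where "wt \<mu> T = (\<Prod>b\<in>young_diagram m \<mu>. \<beta> ^ (card (T b) - 1))" for \<mu> T
  have corner: "finite (corner_rows m lam \<mu>)" for \<mu> by (simp add: corner_rows_def)
  have subset_sum: "(\<Sum>S\<in>Pow (corner_rows m lam \<mu>). \<beta> ^ card S) =
      (\<Prod>i=1..m. if lam (Suc i) < \<mu> i then 1 + \<beta> else 1)" for \<mu>
  proof -
    have "(\<Sum>S\<in>Pow (corner_rows m lam \<mu>). \<beta> ^ card S) = (\<Prod>i\<in>corner_rows m lam \<mu>. \<beta> + 1)"
      by (subst prod_add) (auto simp: corner)
    also have "\<dots> = (\<Prod>i=1..m. if lam (Suc i) < \<mu> i then 1 + \<beta> else 1)"
      unfolding corner_rows_def add.commute[of 1 \<beta>]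
      by (subst prod.inter_filter) simp_all
    finally show ?thesis .
  qed
  have "svt_sum (Suc m) \<beta> lam = (\<Sum>(\<mu>, T, S)\<in>(SIGMA \<mu>:interlacing m lam.
      SVT m \<mu> \<times> Pow (corner_rows m lam \<mu>)). \<beta> ^ card S * wt \<mu> T)"
    unfolding svt_sum_def
  proof (rule sum.reindex_bij_witness[where
        j = "\<lambda>T. (inner_shape m T, \<lambda>b. T b - {Suc m}, shared_rows m T)" and
        i = "\<lambda>(\<mu>, T, S). add_largest m lam \<mu> T S"], goal_cases)
    case (1 T)
    thus ?case by (simp add: add_largest_remove_largest[OF part])
  next
    case (2 T)
    thus ?case
      using inner_shape_interlacing[OF part] remove_largest_SVT[OF part] shared_rows_subset[OF part]
      by simp
  next
    case (3 z)
    thus ?case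
      by (auto simp: inner_shape_add_largest remove_largest_add_largest shared_rows_add_largest)
  next
    case (4 z)
    thus ?case by (auto intro: add_largest_SVT)
  next
    case (5 T)
    thus ?case by (simp only: prod.case wt_def SVT_weight_branching[OF part])
  qed
  also have "\<dots> = (\<Sum>\<mu>\<in>interlacing m lam. \<Sum>T\<in>SVT m \<mu>. \<Sum>S\<in>Pow (corner_rows m lam \<mu>).
      \<beta> ^ card S * wt \<mu> T)"
    by (subst sum.Sigma[symmetric])
       (auto simp: finite_interlacing finite_SVT corner sum.cartesian_product)
  also have "\<dots> = (\<Sum>\<mu>\<in>interlacing m lam.
      (\<Sum>S\<in>Pow (corner_rows m lam \<mu>). \<beta> ^ card S) * svt_sum m \<beta> \<mu>)"
    by (simp add: svt_sum_def wt_def sum_distrib_left sum_distrib_right)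
  finally show ?thesis unfolding subset_sum .
qed

section \<open>Comparison of the two recursions\<close>

lemma svt_sum_eq_grothendieck_det_generic:
  fixes \<beta> :: "'a :: field_char_0"
  assumes "1 + \<beta> \<noteq> 0" "is_partition n lam"
  shows "svt_sum n \<beta> lam = grothendieck_det n \<beta> lam"
  using assms(2)
proof (induction n arbitrary: lam)
  case 0
  have "young_diagram 0 lam = {}" by (auto simp: young_diagram_def)
  moreover from this have "SVT 0 lam = {\<lambda>_. {}}" by (auto simp: SVT_def)
  ultimately show ?case by (simp add: svt_sum_def grothendieck_det_def)
next
  case (Suc m)
  show ?case
    unfolding svt_sum_branching[OF Suc.prems] grothendieck_det_branching[OF assms(1) Suc.prems]
      interlacing_def[symmetric]
    by (intro sum.cong refl arg_cong2[where f = "(*)"] Suc.IH is_partition_interlacing)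
qed

lemma svt_sum_eq_grothendieck_det:
  fixes \<beta> :: complex
  assumes "is_partition n lam"
  shows "svt_sum n \<beta> lam = grothendieck_det n \<beta> lam"
proof (cases "1 + \<beta> = 0")
  case True
  have lim1: "((\<lambda>\<beta>. svt_sum n \<beta> lam) \<longlongrightarrow> svt_sum n \<beta> lam) (at \<beta>)"
    unfolding svt_sum_def by (intro tendsto_intros)
  \<comment> \<open>Continuity of the determinant is read off from its expansion as a finite sum of
    powers of \<open>\<beta>\<close>.\<close>
  have lim2: "((\<lambda>\<beta>. grothendieck_det n \<beta> lam) \<longlongrightarrow> grothendieck_det n \<beta> lam) (at \<beta>)"
    unfolding grothendieck_det_expansion by (intro tendsto_intros)
  have ev: "eventually (\<lambda>\<gamma>. svt_sum n \<gamma> lam = grothendieck_det n \<gamma> lam) (at \<beta>)"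
    unfolding eventually_at_filter
  proof (intro always_eventually allI impI)
    fix \<gamma> :: complex assume "\<gamma> \<noteq> \<beta>"
    hence "1 + \<gamma> \<noteq> 0" using True by (metis add_left_cancel)
    thus "svt_sum n \<gamma> lam = grothendieck_det n \<gamma> lam"
      using assms by (rule svt_sum_eq_grothendieck_det_generic)
  qed
  show ?thesis
    by (rule LIM_unique[OF Lim_transform_eventually[OF lim1 ev] lim2])
qed (rule svt_sum_eq_grothendieck_det_generic[OF _ assms])

lemma grothendieck_at_ones: "grothendieck n lam (\<lambda>_. 1) \<beta> = svt_sum n \<beta> lam"
proof -
  have "svt_size n lam T - size_part n lam = (\<Sum>b\<in>young_diagram n lam. card (T b) - 1)"
    if T: "T \<in> SVT n lam" for T
  proof -
    have "card (T b) = (card (T b) - 1) + 1" if "b \<in> young_diagram n lam" for b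
      using SVT_nonempty[OF T that] finite_SVT_entry[OF T, of b]
      by (metis Suc_eq_plus1 Suc_pred card_gt_0_iff One_nat_def)
    hence "svt_size n lam T = (\<Sum>b\<in>young_diagram n lam. (card (T b) - 1) + 1)"
      unfolding svt_size_def by (rule sum.cong[OF refl])
    also have "\<dots> = (\<Sum>b\<in>young_diagram n lam. card (T b) - 1) + size_part n lam"
      by (simp only: sum.distrib card_young_diagram sum_constant mult_1_right of_nat_id)
    finally show ?thesis by simp
  qed
  thus ?thesis
    by (simp add: grothendieck_def svt_sum_def power_sum)
qed

text \<open>Since \<open>0 ^ 0 = 1\<close>, exactly the tableaux with a single letter in each box
  survive at \<open>\<beta> = 0\<close>; these are the semistandard tableaux.\<close>

lemma card_SST_eq_svt_sum: "of_nat (card (SST n lam)) = svt_sum n (0 :: 'a :: field_char_0) lam"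
proof -
  let ?Y = "young_diagram n lam"
  let ?S = "{T \<in> SVT n lam. \<forall>b\<in>?Y. card (T b) = 1}"
  define f :: "(nat \<times> nat \<Rightarrow> nat) \<Rightarrow> nat \<times> nat \<Rightarrow> nat set"
    where "f T b = (if b \<in> ?Y then {T b} else {})" for T b
  have "inj_on f (SST n lam)"
  proof (rule inj_onI, rule ext)
    fix T U b assume T: "T \<in> SST n lam" and U: "U \<in> SST n lam" and "f T = f U"
    hence "f T b = f U b" by simp
    moreover have "b \<notin> ?Y \<Longrightarrow> T b = U b"
      using T U unfolding SST_def mem_Collect_eq by metis
    ultimately show "T b = U b" by (cases "b \<in> ?Y") (simp_all add: f_def)
  qed
  moreover have "f ` SST n lam = ?S"
  proof (intro equalityI subsetI)
    fix U assume "U \<in> f ` SST n lam"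
    then obtain T where "T \<in> SST n lam" "U = f T" by blast
    thus "U \<in> ?S"
      by (simp add: SST_def SVT_iff f_def del: split_paired_All)
  next
    fix U assume "U \<in> ?S"
    hence U: "U \<in> SVT n lam" and card: "\<And>b. b \<in> ?Y \<Longrightarrow> card (U b) = 1" by auto
    define T where "T b = (if b \<in> ?Y then the_elem (U b) else 0)" for b
    have UT: "U b = {T b}" if b: "b \<in> ?Y" for b
    proof -
      obtain x where "U b = {x}" using card[OF b] by (rule card_1_singletonE)
      thus ?thesis using b by (simp add: T_def)
    qed
    have "U = f T"
      using UT SVT_outside[OF U] by (intro ext) (simp add: f_def)
    moreover have "T \<in> SST n lam"
      unfolding SST_def mem_Collect_eq
    proof (intro conjI allI ballI impI; (elim conjE)?)
      fix b assume "b \<in> ?Y"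
      thus "T b \<in> {1..n}" using SVT_mem(2,3)[OF U, of "T b" b] UT by simp
    next
      fix i j assume "(i, j) \<in> ?Y" "(i, Suc j) \<in> ?Y"
      thus "T (i, j) \<le> T (i, Suc j)" using UT by (intro SVT_row[OF U]) auto
    next
      fix i j assume "(i, j) \<in> ?Y" "(Suc i, j) \<in> ?Y"
      thus "T (i, j) < T (Suc i, j)" using UT by (intro SVT_column[OF U]) auto
    qed (simp add: T_def)
    ultimately show "U \<in> f ` SST n lam" by blast
  qed
  ultimately have "card (SST n lam) = card ?S"
    by (metis card_image)
  moreover have "svt_sum n (0 :: 'a) lam = (\<Sum>T\<in>SVT n lam. if \<forall>b\<in>?Y. card (T b) = 1 then 1 else 0)"
    unfolding svt_sum_def
  proof (rule sum.cong)
    fix T assume T: "T \<in> SVT n lam"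
    have pos: "card (T b) \<noteq> 0" if "b \<in> ?Y" for b
      using SVT_nonempty[OF T that] finite_SVT_entry[OF T] by simp
    show "(\<Prod>b\<in>?Y. (0 :: 'a) ^ (card (T b) - 1)) = (if \<forall>b\<in>?Y. card (T b) = 1 then 1 else 0)"
    proof (cases "\<forall>b\<in>?Y. card (T b) = 1")
      case True
      thus ?thesis by simp
    next
      case False
      then obtain b where b: "b \<in> ?Y" "card (T b) \<noteq> 1" by blast
      hence "(0 :: 'a) ^ (card (T b) - 1) = 0" using pos[OF b(1)] by simp
      thus ?thesis using False b(1) by (auto simp: prod_zero_iff)
    qed
  qed simp
  moreover have "\<dots> = of_nat (card ?S)"
    by (subst sum.inter_filter[symmetric]) (simp_all add: finite_SVT)
  ultimately show ?thesis by simp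
qed

text \<open>The rising factorial of \<open>-(i - 1)\<close> is a falling factorial of
  \<open>i - 1\<close> up to the sign \<open>(-1) ^ k\<close>, which the power of
  \<open>- \<beta>\<close> absorbs.\<close>

lemma pochhammer_negative_quotient:
  fixes \<beta> :: "'a :: field_char_0"
  assumes "1 \<le> i"
  shows "pochhammer (- (of_nat i - 1)) k * (1 / pochhammer 1 k) * (- \<beta>) ^ k =
    of_nat ((i - 1) choose k) * \<beta> ^ k"
proof -
  have "of_nat ((i - 1) choose k) = (of_nat (i - 1) gchoose k :: 'a)"
    by (rule binomial_gbinomial)
  also have "\<dots> = (- 1) ^ k * pochhammer (- of_nat (i - 1)) k / fact k"
    by (rule gbinomial_pochhammer)
  finally show ?thesis
    using assms by (simp add: of_nat_diff pochhammer_fact power_minus[of \<beta>] mult_ac)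
qed

text \<open>Holman's series runs over functions extended by 0, \<open>PiE\<close> over functions
  extended by \<open>undefined\<close>. The summand sees only the values on \<open>I\<close>, so
  exchanging the default value preserves it.\<close>

lemma infsum_finite_support_PiE:
  fixes f :: "(nat \<Rightarrow> nat) \<Rightarrow> 'a :: {topological_comm_monoid_add, t2_space}"
  assumes "finite I" "\<And>i. i \<in> I \<Longrightarrow> finite (B i)"
    and zero: "\<And>k i. i \<in> I \<Longrightarrow> k i \<notin> B i \<Longrightarrow> f k = 0"
    and cong: "\<And>k k'. (\<And>i. i \<in> I \<Longrightarrow> k i = k' i) \<Longrightarrow> f k = f k'"
  shows "infsum f {k. \<forall>i. i \<notin> I \<longrightarrow> k i = 0} = sum f (PiE I B)"
proof -
  let ?S = "{k. (\<forall>i. i \<notin> I \<longrightarrow> k i = 0) \<and> (\<forall>i\<in>I. k i \<in> B i)}"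
  let ?z = "\<lambda>k i. if i \<in> I then k i else 0"
  have bij: "bij_betw ?z (PiE I B) ?S"
    by (rule bij_betw_byWitness[where f' = "\<lambda>k. restrict k I"])
       (auto simp: fun_eq_iff PiE_def extensional_def)
  have "finite ?S"
    using bij_betw_finite[OF bij] finite_PiE[OF assms(1,2)] by simp
  have "infsum f {k. \<forall>i. i \<notin> I \<longrightarrow> k i = 0} = infsum f ?S"
    using zero by (intro infsum_cong_neutral) auto
  also have "\<dots> = sum f ?S"
    using \<open>finite ?S\<close> by (rule infsum_finite)
  also have "\<dots> = (\<Sum>k\<in>PiE I B. f (?z k))"
    by (rule sum.reindex_bij_betw[OF bij, symmetric])
  also have "\<dots> = sum f (PiE I B)"
    by (intro sum.cong refl cong) simp
  finally show ?thesis .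
qed

theorem theorem3p7:
  fixes n :: nat and lam :: "nat \<Rightarrow> nat" and \<beta> :: complex
  assumes "n \<ge> 1" and "is_partition n lam"
  shows "grothendieck n lam (\<lambda>_. 1) \<beta> =
    of_nat (card (SST n lam)) *
    holmanF n (\<lambda>i j. of_int (int (lam i) - int (lam j) + int j - int i))
      1 (\<lambda>i j. - (of_nat i - 1)) 1 (\<lambda>i j. 1) (\<lambda>_. - \<beta>)"
proof -
  define A :: "nat \<Rightarrow> nat \<Rightarrow> complex"
    where "A i j = of_int (int (lam i) - int (lam j) + int j - int i)" for i j
  \<comment> \<open>The product of the leading coefficients of the binomial coefficients. It equals
    the reciprocal of the product of all \<open>j - i\<close> with
    \<open>1 \<le> i < j \<le> n\<close>, so \<open>SST\<close> below is the product formula for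
    semistandard tableaux.\<close>
  define K :: complex where "K = (\<Prod>j<n. 1 / fact (n - Suc j))"
  define P where "P = PiE {1..n} (\<lambda>i::nat. {..<i})"
  define wt where "wt \<gamma> k = (\<Prod>i=1..n. of_nat ((i - 1) choose k i) * \<gamma> ^ k i)"
    for \<gamma> :: complex and k :: "nat \<Rightarrow> nat"
  have det: "grothendieck_det n \<gamma> lam = K * (\<Sum>k\<in>P. wt \<gamma> k *
      (\<Prod>i=1..n. \<Prod>j\<in>{i<..n}. A i j + of_nat (k i) - of_nat (k j)))" for \<gamma>
    unfolding grothendieck_det_expansion K_def P_def wt_def A_def ..
  have mono: "lam j \<le> lam i" if "1 \<le> i" "i \<le> j" "j \<le> n" for i j
    using that(2,3)
  proof (induction j rule: dec_induct)
    case (step j)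
    moreover have "lam (Suc j) \<le> lam j"
      using assms(2) step that(1) by (simp add: is_partition_def)
    ultimately show ?case by simp
  qed simp
  \<comment> \<open>Since \<open>lam\<close> decreases weakly, \<open>A i j\<close> is at least
    \<open>j - i > 0\<close>.\<close>
  have A_nz: "A i j \<noteq> 0" if "i \<in> {1..n}" "j \<in> {i<..n}" for i j
    using mono[of i j] that unfolding A_def of_int_eq_0_iff by simp
  have SST: "of_nat (card (SST n lam)) = K * (\<Prod>i=1..n. \<Prod>j\<in>{i<..n}. A i j)"
  proof -
    let ?k0 = "\<lambda>i\<in>{1..n}. 0 :: nat"
    have "of_nat (card (SST n lam)) = grothendieck_det n (0 :: complex) lam"
      unfolding card_SST_eq_svt_sum svt_sum_eq_grothendieck_det[OF assms(2)] ..
    \<comment> \<open>At \<open>\<beta> = 0\<close> any nonzero \<open>k i\<close> kills the weight,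
      so only the zero tuple is left; \<open>?k0\<close> is restricted to \<open>{1..n}\<close> in
      order to lie in \<open>P\<close>.\<close>
    also have "\<dots> = K * (\<Sum>k\<in>{?k0}. wt 0 k *
      (\<Prod>i=1..n. \<Prod>j\<in>{i<..n}. A i j + of_nat (k i) - of_nat (k j)))"
      unfolding det
    proof (intro arg_cong2[where f = "(*)"] refl sum.mono_neutral_right ballI)
      show "finite P" by (auto simp: P_def intro!: finite_PiE)
      show "{?k0} \<subseteq> P" by (auto simp: P_def)
      fix k assume k: "k \<in> P - {?k0}"
      have "\<exists>i\<in>{1..n}. k i \<noteq> 0"
      proof (rule ccontr)
        assume "\<not> (\<exists>i\<in>{1..n}. k i \<noteq> 0)"
        hence "k = ?k0" using k by (intro ext) (auto simp: P_def PiE_def extensional_def)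
        thus False using k by simp
      qed
      hence "wt 0 k = 0" unfolding wt_def by (intro prod_zero) auto
      thus "wt 0 k * (\<Prod>i=1..n. \<Prod>j\<in>{i<..n}. A i j + of_nat (k i) - of_nat (k j)) = 0" by simp
    qed
    also have "\<dots> = K * (\<Prod>i=1..n. \<Prod>j\<in>{i<..n}. A i j)"
      by (simp add: wt_def)
    finally show ?thesis .
  qed
  have "holmanF n A 1 (\<lambda>i j. - (of_nat i - 1)) 1 (\<lambda>i j. 1) (\<lambda>_. - \<beta>) =
    infsum (\<lambda>k. (\<Prod>i=1..n. \<Prod>j\<in>{i<..n}. (A i j + of_nat (k i) - of_nat (k j)) / A i j) * wt \<beta> k)
      {k. \<forall>i. i \<notin> {1..n} \<longrightarrow> k i = 0}"
    unfolding holmanF_def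
  proof (rule infsum_cong)
    fix k :: "nat \<Rightarrow> nat"
    have "wt \<beta> k = (\<Prod>i=1..n. pochhammer (- (of_nat i - 1)) (k i) * (1 / pochhammer 1 (k i)) * (- \<beta>) ^ k i)"
      unfolding wt_def by (intro prod.cong refl pochhammer_negative_quotient[symmetric]) simp
    thus "(\<Prod>i=1..n. \<Prod>j\<in>{i<..n}. (A i j + of_nat (k i) - of_nat (k j)) / A i j) *
        (\<Prod>j=1..1::nat. \<Prod>i=1..n. pochhammer (- (of_nat i - 1)) (k i)) *
        (\<Prod>j=1..1::nat. \<Prod>i=1..n. 1 / pochhammer 1 (k i)) * (\<Prod>i=1..n. (- \<beta>) ^ k i) =
      (\<Prod>i=1..n. \<Prod>j\<in>{i<..n}. (A i j + of_nat (k i) - of_nat (k j)) / A i j) * wt \<beta> k"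
      by (simp only: prod.distrib mult.assoc atLeastAtMost_singleton prod.insert prod.empty
            finite.emptyI empty_iff not_False_eq_True mult_1_right)
  qed
  \<comment> \<open>A component \<open>k i \<ge> i\<close> makes the binomial coefficient of
    \<open>i - 1\<close> over \<open>k i\<close> vanish, so the series is a finite sum over
    \<open>P\<close>.\<close>
  also have "\<dots> = (\<Sum>k\<in>P.
      (\<Prod>i=1..n. \<Prod>j\<in>{i<..n}. (A i j + of_nat (k i) - of_nat (k j)) / A i j) * wt \<beta> k)"
    unfolding P_def
  proof (rule infsum_finite_support_PiE)
    fix k :: "nat \<Rightarrow> nat" and i assume i: "i \<in> {1..n}" "k i \<notin> {..<i}"
    hence "(i - 1) choose k i = 0" by (intro binomial_eq_0) auto
    hence "wt \<beta> k = 0" unfolding wt_def using i(1) by (intro prod_zero bexI[of _ i]) auto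
    thus "(\<Prod>i=1..n. \<Prod>j\<in>{i<..n}. (A i j + of_nat (k i) - of_nat (k j)) / A i j) * wt \<beta> k = 0"
      by simp
  next
    fix k k' :: "nat \<Rightarrow> nat" assume "\<And>i. i \<in> {1..n} \<Longrightarrow> k i = k' i"
    thus "(\<Prod>i=1..n. \<Prod>j\<in>{i<..n}. (A i j + of_nat (k i) - of_nat (k j)) / A i j) * wt \<beta> k =
      (\<Prod>i=1..n. \<Prod>j\<in>{i<..n}. (A i j + of_nat (k' i) - of_nat (k' j)) / A i j) * wt \<beta> k'"
      unfolding wt_def by (intro arg_cong2[where f = "(*)"] prod.cong refl) auto
  qed auto
  finally have F: "holmanF n A 1 (\<lambda>i j. - (of_nat i - 1)) 1 (\<lambda>i j. 1) (\<lambda>_. - \<beta>) = \<dots>" .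
  \<comment> \<open>The product of the \<open>A i j\<close> supplied by the tableau count clears the
    denominators of the series.\<close>
  have cancel: "(\<Prod>i=1..n. \<Prod>j\<in>{i<..n}. A i j) *
      (\<Prod>i=1..n. \<Prod>j\<in>{i<..n}. (A i j + of_nat (k i) - of_nat (k j)) / A i j) =
    (\<Prod>i=1..n. \<Prod>j\<in>{i<..n}. A i j + of_nat (k i) - of_nat (k j))" for k :: "nat \<Rightarrow> nat"
    unfolding prod.distrib[symmetric]
    by (intro prod.cong refl) (use A_nz in simp)
  have "grothendieck n lam (\<lambda>_. 1) \<beta> = grothendieck_det n \<beta> lam"
    unfolding grothendieck_at_ones by (rule svt_sum_eq_grothendieck_det[OF assms(2)])
  also have "\<dots> = of_nat (card (SST n lam)) *
      holmanF n A 1 (\<lambda>i j. - (of_nat i - 1)) 1 (\<lambda>i j. 1) (\<lambda>_. - \<beta>)"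
    unfolding det SST F cancel[symmetric] by (simp add: sum_distrib_left mult_ac)
  finally show ?thesis unfolding A_def .
qed

end
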